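(* Let $s,r\in\mathbb N_+$, and let $(a^{(\ell)}_{ij})_{i,j=1}^s,(b^{(\ell)}_i)_{i=1}^s$ and $(\tilde a^{(\ell)}_{mn})_{m,n=1}^r,(\tilde b^{(\ell)}_m)_{m=1}^r$ for $\ell=1,2$, and $(\bar a_{mn})_{m,n=1}^r,(\bar b_m)_{m=1}^r$ be real coefficients. Consider the partitioned Runge--Kutta method for the nonlinear stochastic wave equation given, for $i=1,\dots,s$ and $m=1,\dots,r$, by \begin{align*} &U_i^m=u_i^0+\Delta t\sum_{n=1}^r\tilde a^{(1)}_{nm}V_i^n,\qquad V_i^m=v_i^0+\Delta t\sum_{n=1}^r\tilde a^{(2)}_{nm}\big(\delta_x\mathcal W_i^n-f(U_i^n)\big)+\Delta W_i^1\sum_{n=1}^r\bar a_{nm}\,g(U_i^n),\\ &u_i^1=u_i^0+\Delta t\sum_{m=1}^r\tilde b^{(1)}_mV_i^m,\qquad v_i^1=v_i^0+\Delta t\sum_{m=1}^r\tilde b^{(2)}_m\big(\delta_x\mathcal W_i^m-f(U_i^m)\big)+\Delta W_i^1\sum_{m=1}^r\bar b_m\,g(U_i^m),\\ &U_i^m=u_0^m+\Delta x\sum_{j=1}^sa^{(1)}_{ij}\mathcal W_j^m,\qquad \mathcal W_i^m=w_0^m+\Delta x\sum_{j=1}^sa^{(2)}_{ij}\,\delta_x\mathcal W_j^m,\\ &u_1^m=u_0^m+\Delta x\sum_{i=1}^sb^{(1)}_i\mathcal W_i^m,\qquad w_1^m=w_0^m+\Delta x\sum_{i=1}^sb^{(2)}_i\,\delta_x\mathcal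 W_i^m . \end{align*} Suppose that for $1\le i,j\le s$ and $1\le m,n\le r$ \begin{align*} &\bar a_{nm}\tilde b^{(1)}_m+\tilde a^{(1)}_{mn}\bar b_n-\tilde b^{(1)}_m\bar b_n=0,\\ &\tilde a^{(2)}_{nm}\tilde b^{(1)}_m+\tilde a^{(1)}_{mn}\tilde b^{(2)}_n-\tilde b^{(1)}_m\tilde b^{(2)}_n=0,\\ &a^{(2)}_{ij}b^{(1)}_i+a^{(1)}_{ji}b^{(2)}_j-b^{(1)}_ib^{(2)}_j=0 . \end{align*} Then the method admits, almost surely, the discrete multi-symplectic conservation law $$\sum_{i=1}^sb^{(2)}_i\frac1{\Delta t}\big(\mathrm du_i^1\wedge\mathrm dv_i^1-\mathrm du_i^0\wedge\mathrm dv_i^0\big)-\sum_{m=1}^r\tilde b^{(2)}_m\frac1{\Delta x}\big(\mathrm du_1^m\wedge\mathrm dw_1^m-\mathrm du_0^m\wedge\mathrm dw_0^m\big)=0 .$$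
   Context: The stochastic wave equation is $du=v\,dt$, $u_x=w$, $dv-w_x\,dt=-f(u)\,dt+g(u)\circ dW(t)$, where $f=\tilde f'$, $g=\tilde g'$ act pointwise, with $\tilde f,\tilde g$ smooth and $f,g$ globally Lipschitz, and $W$ is an $L^2$-valued $Q$-Wiener process with trace-class $Q$. The method treats one space-time cell $[0,\Delta x]\times[0,\Delta t]$. All quantities are real numbers for each realization of the noise. Stage quantities $U_i^m,V_i^m,\mathcal W_i^m$ approximate $u,v,w$ at spatial stage $i$ and temporal stage $m$; $\delta_x\mathcal W_i^m$ is the stage quantity discretizing $\partial_xw$ there. Superscripts $0,1$ on $u_i,v_i$ refer to times $0,\Delta t$ at spatial stage $i$; subscripts $0,1$ on $u^m,w^m$ refer to $x=0,\Delta x$ at temporal stage $m$ (thus $u_i^1$, indexed by a spatial stage, and $u_1^m$, indexed by a temporal stage, are different families). $\Delta W_i^1$ is the (real-valued) increment of $W$ over $[0,\Delta t]$ at the spatial stage point $i$. $\mathrm d$ (roman) is the exterior derivative: for a fixed realization of the noise, all numerical quantities are regarded as differentiable functions of parameters (e.g. the data), so their differentials satisfy the linearized scheme and noise increments carry no differential. *)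

theory Defs
  imports "HOL-Probability.Probability"
begin

text \<open>
  The space \<open>L\<^sup>2(\<mu>)\<close> is handled through representatives: elements are functions, and equality in
  \<open>L\<^sup>2\<close> is equality almost everywhere.
\<close>

definition L2 :: "'x measure \<Rightarrow> ('x \<Rightarrow> real) set" where
  "L2 \<mu> = {h \<in> borel_measurable \<mu>. integrable \<mu> (\<lambda>x. (h x)\<^sup>2)}"

definition L2_inner :: "'x measure \<Rightarrow> ('x \<Rightarrow> real) \<Rightarrow> ('x \<Rightarrow> real) \<Rightarrow> real" where
  "L2_inner \<mu> h k = (LINT x|\<mu>. h x * k x)"

definition L2_norm :: "'x measure \<Rightarrow> ('x \<Rightarrow> real) \<Rightarrow> real" where
  "L2_norm \<mu> h = sqrt (L2_inner \<mu> h h)"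

definition complete_orthonormal :: "'x measure \<Rightarrow> (nat \<Rightarrow> 'x \<Rightarrow> real) \<Rightarrow> bool" where
  "complete_orthonormal \<mu> e \<longleftrightarrow>
     (\<forall>k. e k \<in> L2 \<mu>) \<and>
     (\<forall>j k. L2_inner \<mu> (e j) (e k) = (if j = k then 1 else 0)) \<and>
     (\<forall>h\<in>L2 \<mu>. (\<forall>k. L2_inner \<mu> h (e k) = 0) \<longrightarrow> (AE x in \<mu>. h x = 0))"

text \<open>
  Bounded, symmetric, nonnegative operators on \<open>L\<^sup>2(\<mu>)\<close> with finite trace. For nonnegative
  operators the sum of \<open>\<langle>Q e\<^sub>k, e\<^sub>k\<rangle>\<close> does not depend on the complete orthonormal system.
\<close>

definition trace_class_covariance ::
    "'x measure \<Rightarrow> (('x \<Rightarrow> real) \<Rightarrow> ('x \<Rightarrow> real)) \<Rightarrow> bool" where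
  "trace_class_covariance \<mu> Q \<longleftrightarrow>
     (\<forall>h\<in>L2 \<mu>. Q h \<in> L2 \<mu>) \<and>
     (\<forall>h\<in>L2 \<mu>. \<forall>k\<in>L2 \<mu>. \<forall>c d. AE x in \<mu>. Q (\<lambda>y. c * h y + d * k y) x = c * Q h x + d * Q k x) \<and>
     (\<exists>C. \<forall>h\<in>L2 \<mu>. L2_norm \<mu> (Q h) \<le> C * L2_norm \<mu> h) \<and>
     (\<forall>h\<in>L2 \<mu>. \<forall>k\<in>L2 \<mu>. L2_inner \<mu> (Q h) k = L2_inner \<mu> h (Q k)) \<and>
     (\<forall>h\<in>L2 \<mu>. 0 \<le> L2_inner \<mu> (Q h) h) \<and>
     (\<exists>e. complete_orthonormal \<mu> e \<and> summable (\<lambda>k. L2_inner \<mu> (Q (e k)) (e k)))"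

definition centered_gaussian :: "'w measure \<Rightarrow> real \<Rightarrow> ('w \<Rightarrow> real) \<Rightarrow> bool" where
  "centered_gaussian M v X \<longleftrightarrow>
     (if v = 0 then (AE \<omega> in M. X \<omega> = 0)
      else distributed M lborel X (\<lambda>y. ennreal (normal_density 0 (sqrt v) y)))"

text \<open>
  An \<open>L\<^sup>2(\<mu>)\<close>-valued \<open>Q\<close>-Wiener process: it starts at zero, has continuous trajectories and
  independent increments, and \<open>W(t) - W(\<sigma>)\<close> is Gaussian with law \<open>N(0, (t - \<sigma>) Q)\<close>. The argument
  order is \<open>W t \<omega> x\<close>. Since \<open>L\<^sup>2\<close>-valued increments are evaluated at points of space, the process is
  given by a representative whose point values are random variables. The Borel sets of the
  separable space \<open>L\<^sup>2\<close> are generated by the functionals \<open>\<langle>-, h\<rangle>\<close>; this is how measurability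
  and independence are expressed.
\<close>

definition Q_Wiener_process ::
    "'w measure \<Rightarrow> 'x measure \<Rightarrow> (('x \<Rightarrow> real) \<Rightarrow> ('x \<Rightarrow> real)) \<Rightarrow> (real \<Rightarrow> 'w \<Rightarrow> 'x \<Rightarrow> real) \<Rightarrow> bool" where
  "Q_Wiener_process M \<mu> Q W \<longleftrightarrow>
     prob_space M \<and> trace_class_covariance \<mu> Q \<and>
     (\<forall>t\<ge>0. \<forall>\<omega>\<in>space M. W t \<omega> \<in> L2 \<mu>) \<and>
     (\<forall>t\<ge>0. \<forall>h\<in>L2 \<mu>. (\<lambda>\<omega>. L2_inner \<mu> (W t \<omega>) h) \<in> borel_measurable M) \<and>
     (\<forall>t\<ge>0. \<forall>x\<in>space \<mu>. (\<lambda>\<omega>. W t \<omega> x) \<in> borel_measurable M) \<and>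
     (AE \<omega> in M. AE x in \<mu>. W 0 \<omega> x = 0) \<and>
     (AE \<omega> in M. \<forall>t\<ge>0.
        ((\<lambda>\<sigma>. L2_norm \<mu> (\<lambda>x. W \<sigma> \<omega> x - W t \<omega> x)) \<longlongrightarrow> 0) (at t within {0..})) \<and>
     (\<forall>n (\<tau> :: nat \<Rightarrow> real). 0 \<le> \<tau> 0 \<and> (\<forall>k<n. \<tau> k < \<tau> (Suc k)) \<longrightarrow>
        prob_space.indep_vars M (\<lambda>_. \<Pi>\<^sub>M h\<in>L2 \<mu>. borel)
          (\<lambda>k \<omega>. \<lambda>h\<in>L2 \<mu>. L2_inner \<mu> (\<lambda>x. W (\<tau> (Suc k)) \<omega> x - W (\<tau> k) \<omega> x) h) {..<n}) \<and>
     (\<forall>\<sigma> t. 0 \<le> \<sigma> \<and> \<sigma> < t \<longrightarrow>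
        (\<forall>h\<in>L2 \<mu>. centered_gaussian M ((t - \<sigma>) * L2_inner \<mu> (Q h) h)
           (\<lambda>\<omega>. L2_inner \<mu> (\<lambda>x. W t \<omega> x - W \<sigma> \<omega> x) h)))"

definition smooth_real :: "(real \<Rightarrow> real) \<Rightarrow> bool" where
  "smooth_real F \<longleftrightarrow> (\<forall>k x. (deriv ^^ k) F field_differentiable at x)"

text \<open>
  The exterior derivative of a function of the parameters, as a one-form (base point first, then
  the tangent vector), and the wedge product of two covectors, as a bilinear form.
\<close>

definition ext_d :: "('p::real_normed_vector \<Rightarrow> real) \<Rightarrow> 'p \<Rightarrow> 'p \<Rightarrow> real" where
  "ext_d \<phi> p = frechet_derivative \<phi> (at p)"

definition wedge :: "('p \<Rightarrow> real) \<Rightarrow> ('p \<Rightarrow> real) \<Rightarrow> 'p \<Rightarrow> 'p \<Rightarrow> real" where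
  "wedge \<alpha> \<beta> \<xi> \<eta> = \<alpha> \<xi> * \<beta> \<eta> - \<alpha> \<eta> * \<beta> \<xi>"

definition dd_wedge ::
    "('p::real_normed_vector \<Rightarrow> real) \<Rightarrow> ('p \<Rightarrow> real) \<Rightarrow> 'p \<Rightarrow> 'p \<Rightarrow> 'p \<Rightarrow> real" where
  "dd_wedge \<phi> \<psi> p = wedge (ext_d \<phi> p) (ext_d \<psi> p)"

end

theory Submission
  imports Defs
begin

text \<open>
  In time and in space the scheme is a partitioned Runge--Kutta method, and its linearization
  is the same method for the differentials. The coefficient conditions are exactly those under
  which all mixed terms cancel when the wedge product of the updates is expanded, which leaves
  one step with a weighted sum of \<open>dU \<and> dZ\<close> over the stages, where \<open>Z = \<delta>\<^sub>xW\<close>; the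
  contributions of \<open>f\<close> and \<open>g\<close> vanish because \<open>d f(U)\<close> and \<open>d g(U)\<close> are multiples of \<open>dU\<close>.
  Summing the time steps over the spatial stages and the space steps over the temporal stages
  gives the same double sum.
\<close>

section \<open>Bilinear algebra of the wedge product\<close>

lemma wedge_self: "wedge \<alpha> \<alpha> \<xi> \<eta> = 0"
  by (simp add: wedge_def)

lemma wedge_add_left: "wedge (\<lambda>z. \<alpha> z + \<beta> z) \<gamma> \<xi> \<eta> = wedge \<alpha> \<gamma> \<xi> \<eta> + wedge \<beta> \<gamma> \<xi> \<eta>"
  by (simp add: wedge_def algebra_simps)

lemma wedge_add_right: "wedge \<gamma> (\<lambda>z. \<alpha> z + \<beta> z) \<xi> \<eta> = wedge \<gamma> \<alpha> \<xi> \<eta> + wedge \<gamma> \<beta> \<xi> \<eta>"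
  by (simp add: wedge_def algebra_simps)

lemma wedge_diff_right: "wedge \<gamma> (\<lambda>z. \<alpha> z - \<beta> z) \<xi> \<eta> = wedge \<gamma> \<alpha> \<xi> \<eta> - wedge \<gamma> \<beta> \<xi> \<eta>"
  by (simp add: wedge_def algebra_simps)

lemma wedge_scale_left: "wedge (\<lambda>z. c * \<alpha> z) \<gamma> \<xi> \<eta> = c * wedge \<alpha> \<gamma> \<xi> \<eta>"
  by (simp add: wedge_def algebra_simps)

lemma wedge_scale_right: "wedge \<gamma> (\<lambda>z. c * \<alpha> z) \<xi> \<eta> = c * wedge \<gamma> \<alpha> \<xi> \<eta>"
  by (simp add: wedge_def algebra_simps)

lemma wedge_sum_left: "wedge (\<lambda>z. \<Sum>i\<in>I. \<alpha> i z) \<gamma> \<xi> \<eta> = (\<Sum>i\<in>I. wedge (\<alpha> i) \<gamma> \<xi> \<eta>)"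
  by (simp add: wedge_def sum_distrib_left sum_distrib_right sum_subtractf)

lemma wedge_sum_right: "wedge \<gamma> (\<lambda>z. \<Sum>i\<in>I. \<alpha> i z) \<xi> \<eta> = (\<Sum>i\<in>I. wedge \<gamma> (\<alpha> i) \<xi> \<eta>)"
  by (simp add: wedge_def sum_distrib_left sum_distrib_right sum_subtractf)

lemmas wedge_bilinear =
  wedge_add_left wedge_add_right wedge_diff_right
  wedge_scale_left wedge_scale_right wedge_sum_left wedge_sum_right

text \<open>The stage equations turn \<open>q\<^sub>0\<close> into \<open>U j\<close> and
  \<open>p\<^sub>0\<close> into \<open>V i\<close> in the expanded product. What remains off the
  diagonal are the products of \<open>V i\<close> with \<open>K j\<close> and \<open>N j\<close>,
  whose coefficients vanish by \<open>BA\<close> and \<open>CA\<close>. Here \<open>K\<close> and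
  \<open>N\<close> are arbitrary covectors, so the identity is purely algebraic.\<close>

lemma partitioned_RK_wedge:
  fixes A B C :: "'i \<Rightarrow> 'i \<Rightarrow> real" and \<beta> \<gamma> \<gamma>' :: "'i \<Rightarrow> real"
  assumes U: "\<And>i. i \<in> I \<Longrightarrow> U i = (\<lambda>z. q\<^sub>0 z + h * (\<Sum>j\<in>I. A i j * V j z))"
    and V: "\<And>i. i \<in> I \<Longrightarrow>
      V i = (\<lambda>z. p\<^sub>0 z + h * (\<Sum>j\<in>I. B i j * K j z) + \<sigma> * (\<Sum>j\<in>I. C i j * N j z))"
    and q: "q\<^sub>1 = (\<lambda>z. q\<^sub>0 z + h * (\<Sum>j\<in>I. \<beta> j * V j z))"
    and p: "p\<^sub>1 = (\<lambda>z. p\<^sub>0 z + h * (\<Sum>j\<in>I. \<gamma> j * K j z) + \<sigma> * (\<Sum>j\<in>I. \<gamma>' j * N j z))"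
    and BA: "\<And>i j. i \<in> I \<Longrightarrow> j \<in> I \<Longrightarrow> B i j * \<beta> i + A j i * \<gamma> j - \<beta> i * \<gamma> j = 0"
    and CA: "\<And>i j. i \<in> I \<Longrightarrow> j \<in> I \<Longrightarrow> C i j * \<beta> i + A j i * \<gamma>' j - \<beta> i * \<gamma>' j = 0"
  shows "wedge q\<^sub>1 p\<^sub>1 \<xi> \<eta> - wedge q\<^sub>0 p\<^sub>0 \<xi> \<eta> =
    h * (\<Sum>j\<in>I. \<gamma> j * wedge (U j) (K j) \<xi> \<eta>) + \<sigma> * (\<Sum>j\<in>I. \<gamma>' j * wedge (U j) (N j) \<xi> \<eta>)"
proof -
  let ?w = "\<lambda>\<alpha> \<beta>. wedge \<alpha> \<beta> \<xi> \<eta>"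
  \<comment> \<open>Solving the stage equation for \<open>p\<^sub>0\<close> leaves no diagonal term,
    since the wedge of \<open>V i\<close> with itself is zero.\<close>
  have Vp: "?w (V i) p\<^sub>0 =
      - h * (\<Sum>j\<in>I. B i j * ?w (V i) (K j)) - \<sigma> * (\<Sum>j\<in>I. C i j * ?w (V i) (N j))"
    if "i \<in> I" for i
  proof -
    have "p\<^sub>0 = (\<lambda>z. V i z - h * (\<Sum>j\<in>I. B i j * K j z) - \<sigma> * (\<Sum>j\<in>I. C i j * N j z))"
      using V[OF that] by (simp add: fun_eq_iff)
    then have "?w (V i) p\<^sub>0 =
      ?w (V i) (\<lambda>z. V i z - h * (\<Sum>j\<in>I. B i j * K j z) - \<sigma> * (\<Sum>j\<in>I. C i j * N j z))"
      by (rule arg_cong)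
    then show ?thesis by (simp add: wedge_bilinear wedge_self)
  qed
  \<comment> \<open>The stage \<open>j\<close> is free here; it is later matched to the index of
    \<open>X\<close>, which produces the diagonal terms \<open>U j\<close> with \<open>K j\<close>
    or \<open>N j\<close>.\<close>
  have qX: "?w q\<^sub>0 X = ?w (U j) X - h * (\<Sum>i\<in>I. A j i * ?w (V i) X)" if "j \<in> I" for j X
    using U[OF that] by (simp add: wedge_bilinear)
  \<comment> \<open>The coefficient condition in summed form, kept generic in \<open>E\<close>,
    \<open>\<delta>\<close> and \<open>X\<close> so that it serves both the \<open>K\<close> terms
    and the \<open>N\<close> terms.\<close>
  have mixed: "(\<Sum>i\<in>I. \<beta> i * (\<Sum>j\<in>I. \<delta> j * ?w (V i) (X j))) =
      (\<Sum>i\<in>I. \<beta> i * (\<Sum>j\<in>I. E i j * ?w (V i) (X j)))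
      + (\<Sum>j\<in>I. \<delta> j * (\<Sum>i\<in>I. A j i * ?w (V i) (X j)))"
    if E: "\<And>i j. i \<in> I \<Longrightarrow> j \<in> I \<Longrightarrow> E i j * \<beta> i + A j i * \<delta> j - \<beta> i * \<delta> j = 0" for E \<delta> X
  proof -
    have "(\<Sum>j\<in>I. \<delta> j * (\<Sum>i\<in>I. A j i * ?w (V i) (X j))) =
        (\<Sum>i\<in>I. \<Sum>j\<in>I. \<delta> j * (A j i * ?w (V i) (X j)))"
      unfolding sum_distrib_left by (rule sum.swap)
    moreover have "\<beta> i * (\<delta> j * y) = \<beta> i * (E i j * y) + \<delta> j * (A j i * y)"
      if "i \<in> I" "j \<in> I" for i j y
      using E[OF that] by algebra
    ultimately show ?thesis
      by (simp add: sum_distrib_left sum.distrib[symmetric])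
  qed
  have "?w q\<^sub>1 p\<^sub>1 - ?w q\<^sub>0 p\<^sub>0 = h * (\<Sum>i\<in>I. \<beta> i * ?w (V i) p\<^sub>0)
      + h * (\<Sum>j\<in>I. \<gamma> j * ?w q\<^sub>0 (K j)) + \<sigma> * (\<Sum>j\<in>I. \<gamma>' j * ?w q\<^sub>0 (N j))
      + h * h * (\<Sum>i\<in>I. \<beta> i * (\<Sum>j\<in>I. \<gamma> j * ?w (V i) (K j)))
      + h * \<sigma> * (\<Sum>i\<in>I. \<beta> i * (\<Sum>j\<in>I. \<gamma>' j * ?w (V i) (N j)))"
  proof -
    have q1: "?w q\<^sub>1 X = ?w q\<^sub>0 X + h * (\<Sum>i\<in>I. \<beta> i * ?w (V i) X)" for X
      by (simp add: q wedge_bilinear)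
    have p1: "?w X p\<^sub>1 = ?w X p\<^sub>0
        + h * (\<Sum>j\<in>I. \<gamma> j * ?w X (K j)) + \<sigma> * (\<Sum>j\<in>I. \<gamma>' j * ?w X (N j))" for X
      by (simp add: p wedge_bilinear)
    show ?thesis
      unfolding q1[of p\<^sub>1] unfolding p1
      by (simp add: distrib_left sum.distrib sum_distrib_left mult_ac)
  qed
  also have "(\<Sum>i\<in>I. \<beta> i * ?w (V i) p\<^sub>0) =
      - h * (\<Sum>i\<in>I. \<beta> i * (\<Sum>j\<in>I. B i j * ?w (V i) (K j)))
      - \<sigma> * (\<Sum>i\<in>I. \<beta> i * (\<Sum>j\<in>I. C i j * ?w (V i) (N j)))"
    by (simp add: Vp right_diff_distrib sum_subtractf sum_negf sum_distrib_left mult_ac)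
  also have "(\<Sum>j\<in>I. \<gamma> j * ?w q\<^sub>0 (K j)) = (\<Sum>j\<in>I. \<gamma> j * ?w (U j) (K j))
      - h * (\<Sum>j\<in>I. \<gamma> j * (\<Sum>i\<in>I. A j i * ?w (V i) (K j)))"
  proof -
    have "(\<Sum>j\<in>I. \<gamma> j * ?w q\<^sub>0 (K j)) =
        (\<Sum>j\<in>I. \<gamma> j * (?w (U j) (K j) - h * (\<Sum>i\<in>I. A j i * ?w (V i) (K j))))"
      \<comment> \<open>The left side of \<open>qX\<close> does not determine \<open>j\<close>, so
        it cannot be a rewrite rule; unification with each summand fixes the stage.\<close>
      by (intro sum.cong refl arg_cong2[where f = "(*)"] qX)
    then show ?thesis
      by (simp add: right_diff_distrib sum_subtractf sum_distrib_left mult_ac)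
  qed
  also have "(\<Sum>j\<in>I. \<gamma>' j * ?w q\<^sub>0 (N j)) = (\<Sum>j\<in>I. \<gamma>' j * ?w (U j) (N j))
      - h * (\<Sum>j\<in>I. \<gamma>' j * (\<Sum>i\<in>I. A j i * ?w (V i) (N j)))"
  proof -
    have "(\<Sum>j\<in>I. \<gamma>' j * ?w q\<^sub>0 (N j)) =
        (\<Sum>j\<in>I. \<gamma>' j * (?w (U j) (N j) - h * (\<Sum>i\<in>I. A j i * ?w (V i) (N j))))"
      by (intro sum.cong refl arg_cong2[where f = "(*)"] qX)
    then show ?thesis
      by (simp add: right_diff_distrib sum_subtractf sum_distrib_left mult_ac)
  qed
  finally show ?thesis
    \<comment> \<open>The first instance cancels all terms of order \<open>h * h\<close>, the second
      all those with factor \<open>h * \<sigma>\<close>.\<close>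
    using mixed[of B \<gamma> K] mixed[of C \<gamma>' N] BA CA by (simp add: algebra_simps)
qed

section \<open>Linearization of the scheme\<close>

lemma ext_d_has_derivative:
  assumes "\<phi> differentiable at p"
  shows "(\<phi> has_derivative ext_d \<phi> p) (at p)"
  using assms unfolding ext_d_def by (simp add: frechet_derivative_works)

text \<open>Derivatives depend only on values near the point, so an equation of the scheme that
  holds on an open parameter set may be differentiated on both sides.\<close>

lemma ext_d_eqI:
  assumes "open P" "p \<in> P" and "\<And>q. q \<in> P \<Longrightarrow> \<phi> q = \<psi> q"
    and "(\<psi> has_derivative D) (at p)"
  shows "ext_d \<phi> p = D"
proof -
  have "(\<phi> has_derivative D) (at p)"
    by (rule has_derivative_transform_within_open[OF assms(4,1,2)]) (simp add: assms(3))
  then show ?thesis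
    unfolding ext_d_def by (rule frechet_derivative_at[symmetric])
qed

lemma has_derivative_comp_ext_d:
  assumes "k field_differentiable at (\<phi> p)" and "\<phi> differentiable at p"
  shows "((\<lambda>q. k (\<phi> q)) has_derivative (\<lambda>z. deriv k (\<phi> p) * ext_d \<phi> p z)) (at p)"
proof -
  have "(k has_derivative (*) (deriv k (\<phi> p))) (at (\<phi> p))"
    using assms(1) by (simp add: field_differentiable_derivI flip: has_field_derivative_def)
  from has_derivative_compose[OF ext_d_has_derivative[OF assms(2)] this]
  show ?thesis .
qed

text \<open>Differentiation turns the nonlinear method into the linear one of
  \<open>partitioned_RK_wedge\<close>. The factor \<open>\<sigma>\<close> is constant in the
  parameters, which reflects that noise increments carry no differential. The index set is abstract
  so that both directions of the cell are covered.\<close>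

lemma partitioned_RK_dd_wedge:
  fixes A B C :: "'i \<Rightarrow> 'i \<Rightarrow> real" and \<beta> \<gamma> \<gamma>' :: "'i \<Rightarrow> real"
    and P :: "'p::real_normed_vector set"
  assumes P: "open P" "p \<in> P"
    and f: "\<And>y. f field_differentiable at y" and g: "\<And>y. g field_differentiable at y"
    and dU: "\<And>i. i \<in> I \<Longrightarrow> U i differentiable at p"
    and dV: "\<And>i. i \<in> I \<Longrightarrow> V i differentiable at p"
    and dZ: "\<And>i. i \<in> I \<Longrightarrow> Z i differentiable at p"
    and dq: "q\<^sub>0 differentiable at p" and dp: "p\<^sub>0 differentiable at p"
    and U: "\<And>i y. i \<in> I \<Longrightarrow> y \<in> P \<Longrightarrow> U i y = q\<^sub>0 y + h * (\<Sum>j\<in>I. A i j * V j y)"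
    and V: "\<And>i y. i \<in> I \<Longrightarrow> y \<in> P \<Longrightarrow> V i y = p\<^sub>0 y
      + h * (\<Sum>j\<in>I. B i j * (Z j y - f (U j y))) + \<sigma> * (\<Sum>j\<in>I. C i j * g (U j y))"
    and q: "\<And>y. y \<in> P \<Longrightarrow> q\<^sub>1 y = q\<^sub>0 y + h * (\<Sum>j\<in>I. \<beta> j * V j y)"
    and p: "\<And>y. y \<in> P \<Longrightarrow> p\<^sub>1 y = p\<^sub>0 y
      + h * (\<Sum>j\<in>I. \<gamma> j * (Z j y - f (U j y))) + \<sigma> * (\<Sum>j\<in>I. \<gamma>' j * g (U j y))"
    and BA: "\<And>i j. i \<in> I \<Longrightarrow> j \<in> I \<Longrightarrow> B i j * \<beta> i + A j i * \<gamma> j - \<beta> i * \<gamma> j = 0"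
    and CA: "\<And>i j. i \<in> I \<Longrightarrow> j \<in> I \<Longrightarrow> C i j * \<beta> i + A j i * \<gamma>' j - \<beta> i * \<gamma>' j = 0"
  shows "dd_wedge q\<^sub>1 p\<^sub>1 p \<xi> \<eta> - dd_wedge q\<^sub>0 p\<^sub>0 p \<xi> \<eta> =
    h * (\<Sum>j\<in>I. \<gamma> j * dd_wedge (U j) (Z j) p \<xi> \<eta>)"
proof -
  \<comment> \<open>\<open>K j\<close> and \<open>N j\<close> are the differentials of the drift and
    noise terms at stage \<open>j\<close>, by the chain rule.\<close>
  define K where "K j z = ext_d (Z j) p z - deriv f (U j p) * ext_d (U j) p z" for j z
  define N where "N j z = deriv g (U j p) * ext_d (U j) p z" for j z
  note hd [derivative_intros] =
    ext_d_has_derivative[OF dU] ext_d_has_derivative[OF dV] ext_d_has_derivative[OF dZ]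
    ext_d_has_derivative[OF dq] ext_d_has_derivative[OF dp]
    has_derivative_comp_ext_d[OF f dU] has_derivative_comp_ext_d[OF g dU]
  have "wedge (ext_d q\<^sub>1 p) (ext_d p\<^sub>1 p) \<xi> \<eta> - wedge (ext_d q\<^sub>0 p) (ext_d p\<^sub>0 p) \<xi> \<eta> =
      h * (\<Sum>j\<in>I. \<gamma> j * wedge (ext_d (U j) p) (K j) \<xi> \<eta>)
      + \<sigma> * (\<Sum>j\<in>I. \<gamma>' j * wedge (ext_d (U j) p) (N j) \<xi> \<eta>)"
  proof (rule partitioned_RK_wedge[where V = "\<lambda>i. ext_d (V i) p", OF _ _ _ _ BA CA])
    show "ext_d (U i) p = (\<lambda>z. ext_d q\<^sub>0 p z + h * (\<Sum>j\<in>I. A i j * ext_d (V j) p z))"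
      if "i \<in> I" for i
      by (rule ext_d_eqI[OF P U[OF that]]) (auto intro!: derivative_eq_intros)
    show "ext_d (V i) p = (\<lambda>z. ext_d p\<^sub>0 p z
        + h * (\<Sum>j\<in>I. B i j * K j z) + \<sigma> * (\<Sum>j\<in>I. C i j * N j z))" if "i \<in> I" for i
      unfolding K_def N_def
      by (rule ext_d_eqI[OF P V[OF that]]) (auto intro!: derivative_eq_intros)
    show "ext_d q\<^sub>1 p = (\<lambda>z. ext_d q\<^sub>0 p z + h * (\<Sum>j\<in>I. \<beta> j * ext_d (V j) p z))"
      by (rule ext_d_eqI[OF P q]) (auto intro!: derivative_eq_intros)
    show "ext_d p\<^sub>1 p = (\<lambda>z. ext_d p\<^sub>0 p z
        + h * (\<Sum>j\<in>I. \<gamma> j * K j z) + \<sigma> * (\<Sum>j\<in>I. \<gamma>' j * N j z))"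
      unfolding K_def N_def
      by (rule ext_d_eqI[OF P p]) (auto intro!: derivative_eq_intros)
  qed
  moreover have "wedge (ext_d (U j) p) (K j) = wedge (ext_d (U j) p) (ext_d (Z j) p)" for j
    unfolding K_def by (simp add: fun_eq_iff wedge_bilinear wedge_self)
  moreover have "wedge (ext_d (U j) p) (N j) \<xi> \<eta> = 0" for j
    unfolding N_def by (simp add: wedge_bilinear wedge_self)
  ultimately show ?thesis
    by (simp add: dd_wedge_def)
qed

lemma smooth_real_deriv: "smooth_real F \<Longrightarrow> deriv F field_differentiable at y"
  \<comment> \<open>This is the case \<open>k = 1\<close>, where the iterated derivative is
    \<open>deriv F\<close> itself.\<close>
  unfolding smooth_real_def using funpow_0 by (metis One_nat_def comp_id funpow.simps)

theorem theorem5p1: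
  fixes s r :: nat
    and a :: "nat \<Rightarrow> nat \<Rightarrow> nat \<Rightarrow> real" and b :: "nat \<Rightarrow> nat \<Rightarrow> real"
    and atil :: "nat \<Rightarrow> nat \<Rightarrow> nat \<Rightarrow> real" and btil :: "nat \<Rightarrow> nat \<Rightarrow> real"
    and abar :: "nat \<Rightarrow> nat \<Rightarrow> real" and bbar :: "nat \<Rightarrow> real"
    and \<Delta>t \<Delta>x :: real
    and F G f g :: "real \<Rightarrow> real"
    and M :: "'w measure" and D :: "real set"
    and Q :: "(real \<Rightarrow> real) \<Rightarrow> (real \<Rightarrow> real)" and W :: "real \<Rightarrow> 'w \<Rightarrow> real \<Rightarrow> real"
    and x :: "nat \<Rightarrow> real" and \<Delta>W :: "nat \<Rightarrow> 'w \<Rightarrow> real"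
    and P :: "'p::real_normed_vector set"
    and U V \<W> \<delta>\<W> :: "nat \<Rightarrow> nat \<Rightarrow> 'w \<Rightarrow> 'p \<Rightarrow> real"
    and ut vt ux wx :: "nat \<Rightarrow> nat \<Rightarrow> 'w \<Rightarrow> 'p \<Rightarrow> real"
  assumes "s \<ge> 1" "r \<ge> 1" and "\<Delta>t > 0" "\<Delta>x > 0"
    and "smooth_real F" "smooth_real G" "f = deriv F" "g = deriv G"
    and "\<exists>L. L-lipschitz_on UNIV f" "\<exists>L. L-lipschitz_on UNIV g"
    and "D \<in> sets lebesgue" "{0..\<Delta>x} \<subseteq> D"
    and "Q_Wiener_process M (lebesgue_on D) Q W"
    and "\<And>i. i \<in> {1..s} \<Longrightarrow> x i \<in> D"
    and "\<And>i \<omega>. i \<in> {1..s} \<Longrightarrow> \<omega> \<in> space M \<Longrightarrow> \<Delta>W i \<omega> = W \<Delta>t \<omega> (x i) - W 0 \<omega> (x i)"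
    and "open P"
    and differentiable: "AE \<omega> in M. \<forall>p\<in>P. \<forall>i\<in>{1..s}. \<forall>m\<in>{1..r}.
         U i m \<omega> differentiable at p \<and> V i m \<omega> differentiable at p \<and>
         \<W> i m \<omega> differentiable at p \<and> \<delta>\<W> i m \<omega> differentiable at p \<and>
         (\<forall>k\<in>{0, 1}. ut k i \<omega> differentiable at p \<and> vt k i \<omega> differentiable at p \<and>
                     ux k m \<omega> differentiable at p \<and> wx k m \<omega> differentiable at p)"
    and scheme: "AE \<omega> in M. \<forall>p\<in>P. \<forall>i\<in>{1..s}. \<forall>m\<in>{1..r}.
         U i m \<omega> p = ut 0 i \<omega> p + \<Delta>t * (\<Sum>n=1..r. atil 1 n m * V i n \<omega> p) \<and>
         V i m \<omega> p = vt 0 i \<omega> p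
             + \<Delta>t * (\<Sum>n=1..r. atil 2 n m * (\<delta>\<W> i n \<omega> p - f (U i n \<omega> p)))
             + \<Delta>W i \<omega> * (\<Sum>n=1..r. abar n m * g (U i n \<omega> p)) \<and>
         ut 1 i \<omega> p = ut 0 i \<omega> p + \<Delta>t * (\<Sum>n=1..r. btil 1 n * V i n \<omega> p) \<and>
         vt 1 i \<omega> p = vt 0 i \<omega> p
             + \<Delta>t * (\<Sum>n=1..r. btil 2 n * (\<delta>\<W> i n \<omega> p - f (U i n \<omega> p)))
             + \<Delta>W i \<omega> * (\<Sum>n=1..r. bbar n * g (U i n \<omega> p)) \<and>
         U i m \<omega> p = ux 0 m \<omega> p + \<Delta>x * (\<Sum>j=1..s. a 1 i j * \<W> j m \<omega> p) \<and>
         \<W> i m \<omega> p = wx 0 m \<omega> p + \<Delta>x * (\<Sum>j=1..s. a 2 i j * \<delta>\<W> j m \<omega> p) \<and>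
         ux 1 m \<omega> p = ux 0 m \<omega> p + \<Delta>x * (\<Sum>j=1..s. b 1 j * \<W> j m \<omega> p) \<and>
         wx 1 m \<omega> p = wx 0 m \<omega> p + \<Delta>x * (\<Sum>j=1..s. b 2 j * \<delta>\<W> j m \<omega> p)"
    and "\<And>m n. m \<in> {1..r} \<Longrightarrow> n \<in> {1..r} \<Longrightarrow>
         abar n m * btil 1 m + atil 1 m n * bbar n - btil 1 m * bbar n = 0"
    and "\<And>m n. m \<in> {1..r} \<Longrightarrow> n \<in> {1..r} \<Longrightarrow>
         atil 2 n m * btil 1 m + atil 1 m n * btil 2 n - btil 1 m * btil 2 n = 0"
    and "\<And>i j. i \<in> {1..s} \<Longrightarrow> j \<in> {1..s} \<Longrightarrow>
         a 2 i j * b 1 i + a 1 j i * b 2 j - b 1 i * b 2 j = 0"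
  shows "AE \<omega> in M. \<forall>p\<in>P. \<forall>\<xi> \<eta>.
         (\<Sum>i=1..s. b 2 i * (1 / \<Delta>t) *
            (dd_wedge (ut 1 i \<omega>) (vt 1 i \<omega>) p \<xi> \<eta> - dd_wedge (ut 0 i \<omega>) (vt 0 i \<omega>) p \<xi> \<eta>))
       - (\<Sum>m=1..r. btil 2 m * (1 / \<Delta>x) *
            (dd_wedge (ux 1 m \<omega>) (wx 1 m \<omega>) p \<xi> \<eta> - dd_wedge (ux 0 m \<omega>) (wx 0 m \<omega>) p \<xi> \<eta>)) = 0"
proof -
  have f: "f field_differentiable at y" for y
    using \<open>smooth_real F\<close> \<open>f = deriv F\<close> by (simp add: smooth_real_deriv)
  have g: "g field_differentiable at y" for y
    using \<open>smooth_real G\<close> \<open>g = deriv G\<close> by (simp add: smooth_real_deriv)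
  \<comment> \<open>Outside a null set both hypotheses hold together, and the rest is deterministic
    for a fixed \<open>\<omega>\<close>.\<close>
  from differentiable scheme show ?thesis
  proof eventually_elim
    case (elim \<omega>)
    \<comment> \<open>The hypotheses quantify over \<open>i\<close> and \<open>m\<close> jointly;
      extracting a fact about only one index needs a valid value of the other.\<close>
    have one: "1 \<in> {1..s}" "1 \<in> {1..r}"
      using \<open>s \<ge> 1\<close> \<open>r \<ge> 1\<close> by auto
    show ?case
    proof (intro ballI allI)
      fix p \<xi> \<eta> assume p: "p \<in> P"
      let ?S = "\<lambda>i m. dd_wedge (U i m \<omega>) (\<delta>\<W> i m \<omega>) p \<xi> \<eta>"
      \<comment> \<open>The temporal sums run over the first index of the coefficients, so the
        matrices enter the lemma transposed.\<close>
      have "dd_wedge (ut 1 i \<omega>) (vt 1 i \<omega>) p \<xi> \<eta> - dd_wedge (ut 0 i \<omega>) (vt 0 i \<omega>) p \<xi> \<eta> =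
          \<Delta>t * (\<Sum>m=1..r. btil 2 m * ?S i m)" if i: "i \<in> {1..s}" for i
        by (rule partitioned_RK_dd_wedge[where P = P and f = f and g = g
              and V = "\<lambda>m. V i m \<omega>" and A = "\<lambda>m n. atil 1 n m" and B = "\<lambda>m n. atil 2 n m"
              and C = "\<lambda>m n. abar n m" and \<beta> = "btil 1" and \<gamma>' = bbar and \<sigma> = "\<Delta>W i \<omega>"])
          (use elim i one p f g \<open>open P\<close> assms(19,20) in blast)+
      \<comment> \<open>In space there is neither drift nor noise: \<open>f\<close>,
        \<open>g\<close> and \<open>\<sigma>\<close> are zero, and the vacuous terms are unfolded
        away so that the premises match the scheme. The matrices are not transposed here.\<close>
      moreover have "dd_wedge (ux 1 m \<omega>) (wx 1 m \<omega>) p \<xi> \<eta> - dd_wedge (ux 0 m \<omega>) (wx 0 m \<omega>) p \<xi> \<eta> =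
          \<Delta>x * (\<Sum>i=1..s. b 2 i * ?S i m)" if m: "m \<in> {1..r}" for m
        by (rule partitioned_RK_dd_wedge[where P = P and f = "\<lambda>_. 0" and g = "\<lambda>_. 0"
              and V = "\<lambda>i. \<W> i m \<omega>" and A = "a 1" and B = "a 2"
              and C = "\<lambda>_ _. 0" and \<beta> = "b 1" and \<gamma>' = "\<lambda>_. 0" and \<sigma> = 0],
            unfold diff_zero mult_zero_left add_0_right)
          (use elim m one p \<open>open P\<close> assms(21) in \<open>blast | simp\<close>)+
      \<comment> \<open>Each direction supplies one weight through its own step identity and takes
        the other from the conservation law; the factors \<open>\<Delta>t\<close> and
        \<open>\<Delta>x\<close> cancel at the end because they are nonzero.\<close>
      moreover have "(\<Sum>i=1..s. b 2 i * (\<Sum>m=1..r. btil 2 m * ?S i m)) =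
          (\<Sum>m=1..r. btil 2 m * (\<Sum>i=1..s. b 2 i * ?S i m))"
        unfolding sum_distrib_left by (subst sum.swap) (simp add: mult_ac)
      ultimately show "(\<Sum>i=1..s. b 2 i * (1 / \<Delta>t) *
            (dd_wedge (ut 1 i \<omega>) (vt 1 i \<omega>) p \<xi> \<eta> - dd_wedge (ut 0 i \<omega>) (vt 0 i \<omega>) p \<xi> \<eta>))
       - (\<Sum>m=1..r. btil 2 m * (1 / \<Delta>x) *
            (dd_wedge (ux 1 m \<omega>) (wx 1 m \<omega>) p \<xi> \<eta> - dd_wedge (ux 0 m \<omega>) (wx 0 m \<omega>) p \<xi> \<eta>)) = 0"
        using \<open>\<Delta>t > 0\<close> \<open>\<Delta>x > 0\<close> by simp
    qed
  qed
qed

end
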